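(* Let $(X_n)_{n\ge 0}$ be a homogeneous Markov chain on the general state space $(S,\mathcal B(S))$ with $n$-step transition kernels $P_x(n,\cdot)$, let $\mu$ be a stationary probability measure of the chain, and let $V$ be the operator defined in the context, with spectral radius $r(V)$. Then, in all cases (in particular, without assuming that $\inf_{x,x'\in S}\kappa(x,x')>0$), for every $x^1\in S$, $$ \limsup_{n\to\infty}\frac1n\ln\|P_{x^1}(n,\cdot)-\mu(\cdot)\|_{TV}\;\le\;\limsup_{n\to\infty}\frac1n\ln\int V^n1(x^1,x^2)\,\mu(dx^2)\;\le\;\ln r(V), $$ where $1$ denotes the function identically equal to one on $\hat S^2$.
   Context: $S$ is a topological space with Borel sigma-algebra $\mathcal B(S)$. $P_x(n,A)$ is the probability that $X_n\in A$ given $X_0=x$; write $P_x(dy)=P_x(1,dy)$. Integrals of bounded Borel functions against $P_x(1,\cdot)$ are Borel measurable in $x$. A probability measure $\mu$ is stationary if $\int P_x(1,A)\,\mu(dx)=\mu(A)$ for all $A\in\mathcal B(S)$. $\|\cdot\|_{TV}$ is the total variation distance between measures. Convention: $\ln 0=-\infty$. For $x,x'\in S$ let $\Lambda_{x,x'}(dy)=P_x(1,dy)+P_{x'}(1,dy)$, and let $p(x,\cdot)=\frac{dP_x(1,\cdot)}{d\Lambda_{x,x'}}$ and $p(x',\cdot)=\frac{dP_{x'}(1,\cdot)}{d\Lambda_{x,x'}}$ be the densities with respect to this measure (which depends on the pair). Define $$\kappa(x,x')=\int \big(p(x,y)\wedge p(x',y)\big)\,\Lambda_{x,x'}(dy)\in[0,1].$$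 (Equivalently, $\kappa(x,x')=\int\left(\frac{P_{x'}(1,dy)}{P_x(1,dy)}\wedge 1\right)P_x(1,dy)$, where the ratio is the density of the absolutely continuous component.) Let $\mathrm{diag}(S^2)=\{(x^1,x^2)\in S\times S: x^1=x^2\}$ and $\hat S^2=(S\times S)\setminus \mathrm{diag}(S^2)$. For $(x^1,x^2)\in\hat S^2$ with $\kappa(x^1,x^2)<1$, define probability measures on $S$ by $$Q^1_{x^1,x^2}(du)=\frac{p(x^1,u)-p(x^1,u)\wedge p(x^2,u)}{1-\kappa(x^1,x^2)}\,\Lambda_{x^1,x^2}(du),\qquad Q^2_{x^1,x^2}(du)=\frac{p(x^2,u)-p(x^1,u)\wedge p(x^2,u)}{1-\kappa(x^1,x^2)}\,\Lambda_{x^1,x^2}(du).$$ These two measures are mutually singular. Let $\hat X_n$ be the Markov process on $\hat S^2$ whose one-step transition law from $(x^1,x^2)$ is the product measure $Q^1_{x^1,x^2}\otimes Q^2_{x^1,x^2}$ (this is the law of the next state of the coupled pair of copies of the chain, conditional on no coupling occurring at that step). The operator $V$ acts on bounded measurable functions $h$ on $\hat S^2$ by $$Vh(x^1,x^2)=(1-\kappa(x^1,x^2))\,\mathbb E_{x^1,x^2}h(\hat X_1)=(1-\kappa(x^1,x^2))\int\!\!\int h(u,v)\,Q^1_{x^1,x^2}(du)\,Q^2_{x^1,x^2}(dv),$$ with $Vh(x^1,x^2)=0$ if $\kappa(x^1,x^2)=1$. Measurability conventions: $\mathrm{diag}(S^2)$ is measurable in $S\times S$ with the product sigma-algebra, $\kappa$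 is measurable, and $V$ maps bounded measurable functions on $\hat S^2$ to bounded measurable functions. The operator norm is with respect to the sup-norm, $\|V\|=\sup_{|h|_B\le1}|Vh|_B$ with $|h|_B=\sup_{x}|h(x)|$, and $r(V)=\lim_{n\to\infty}\|V^n\|^{1/n}$ is the spectral radius of $V$. In the integral over $x^2$, the value of $V^n1$ at diagonal points $x^2=x^1$ is taken to be $0$. *)

theory Defs
  imports "HOL-Probability.Probability"
begin

definition markov_kernel :: "('s::topological_space \<Rightarrow> 's measure) \<Rightarrow> bool" where
  "markov_kernel P \<longleftrightarrow> P \<in> borel \<rightarrow>\<^sub>M prob_algebra borel"

primrec nstep :: "('s::topological_space \<Rightarrow> 's measure) \<Rightarrow> nat \<Rightarrow> 's \<Rightarrow> 's measure" where
  "nstep P 0 x = return borel x"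
| "nstep P (Suc n) x = nstep P n x \<bind> P"

definition stationary :: "('s::topological_space \<Rightarrow> 's measure) \<Rightarrow> 's measure \<Rightarrow> bool" where
  "stationary P \<mu> \<longleftrightarrow> prob_space \<mu> \<and> sets \<mu> = sets borel \<and>
     (\<forall>A\<in>sets borel. (\<integral>x. measure (P x) A \<partial>\<mu>) = measure \<mu> A)"

text \<open>For probability measures this is half the total variation norm of their difference; the factor 2 does not affect
  exponential rates.\<close>

definition tv_dist :: "'a measure \<Rightarrow> 'a measure \<Rightarrow> real" where
  "tv_dist M N = (SUP A\<in>sets M. \<bar>measure M A - measure N A\<bar>)"

definition add_measure :: "'a measure \<Rightarrow> 'a measure \<Rightarrow> 'a measure" where
  "add_measure M N = measure_of (space M) (sets M) (\<lambda>A. emeasure M A + emeasure N A)"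

lemma emeasure_add_measure:
  assumes "sets N = sets M" "A \<in> sets M"
  shows "emeasure (add_measure M N) A = emeasure M A + emeasure N A"
  unfolding add_measure_def
proof (rule emeasure_measure_of_sigma)
  show "sigma_algebra (space M) (sets M)" ..
  show "positive (sets M) (\<lambda>A. emeasure M A + emeasure N A)"
    by (simp add: positive_def)
  show "countably_additive (sets M) (\<lambda>A. emeasure M A + emeasure N A)"
    using assms(1)
    by (auto intro!: countably_additiveI simp: suminf_add[symmetric] suminf_emeasure)
qed fact

definition Lam :: "('s \<Rightarrow> 's measure) \<Rightarrow> 's \<Rightarrow> 's \<Rightarrow> 's measure" where
  "Lam P x x' = add_measure (P x) (P x')"

text \<open>\<open>dens P x x' z\<close>, used for \<open>z \<in> {x, x'}\<close>, is a version of the density of \<open>P z\<close> with respect to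
  \<open>Lam P x x'\<close>.\<close>

definition dens :: "('s \<Rightarrow> 's measure) \<Rightarrow> 's \<Rightarrow> 's \<Rightarrow> 's \<Rightarrow> 's \<Rightarrow> real" where
  "dens P x x' z y = enn2real (RN_deriv (Lam P x x') (P z) y)"

definition min_dens :: "('s \<Rightarrow> 's measure) \<Rightarrow> 's \<Rightarrow> 's \<Rightarrow> 's \<Rightarrow> real" where
  "min_dens P x x' y = min (dens P x x' x y) (dens P x x' x' y)"

definition kappa :: "('s \<Rightarrow> 's measure) \<Rightarrow> 's \<Rightarrow> 's \<Rightarrow> real" where
  "kappa P x x' = (\<integral>y. min_dens P x x' y \<partial>Lam P x x')"

definition offdiag :: "('s \<times> 's) set" where
  "offdiag = - Id"

definition Q1 :: "('s \<Rightarrow> 's measure) \<Rightarrow> 's \<Rightarrow> 's \<Rightarrow> 's measure" where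
  "Q1 P x1 x2 = density (Lam P x1 x2)
     (\<lambda>u. ennreal ((dens P x1 x2 x1 u - min_dens P x1 x2 u) / (1 - kappa P x1 x2)))"

definition Q2 :: "('s \<Rightarrow> 's measure) \<Rightarrow> 's \<Rightarrow> 's \<Rightarrow> 's measure" where
  "Q2 P x1 x2 = density (Lam P x1 x2)
     (\<lambda>u. ennreal ((dens P x1 x2 x2 u - min_dens P x1 x2 u) / (1 - kappa P x1 x2)))"

text \<open>One-step law of the coupled pair conditioned on not coupling. The product measure is carried by
  \<open>offdiag\<close> because its factors are mutually singular, so restricting loses no mass.\<close>

definition hat_kernel :: "('s \<Rightarrow> 's measure) \<Rightarrow> 's \<times> 's \<Rightarrow> ('s \<times> 's) measure" where
  "hat_kernel P = (\<lambda>(x1, x2). restrict_space (Q1 P x1 x2 \<Otimes>\<^sub>M Q2 P x1 x2) offdiag)"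

text \<open>Functions on \<open>offdiag\<close> are represented by functions on all pairs whose values on the diagonal
  are ignored by every notion below. \<open>V_op\<close> returns 0 there.\<close>

definition V_op :: "('s \<Rightarrow> 's measure) \<Rightarrow> ('s \<times> 's \<Rightarrow> real) \<Rightarrow> 's \<times> 's \<Rightarrow> real" where
  "V_op P h = (\<lambda>(x1, x2). if x1 = x2 \<or> kappa P x1 x2 = 1 then 0
     else (1 - kappa P x1 x2) * (\<integral>z. h z \<partial>hat_kernel P (x1, x2)))"

definition bdd_meas :: "('s::topological_space \<times> 's \<Rightarrow> real) \<Rightarrow> bool" where
  "bdd_meas h \<longleftrightarrow> h \<in> borel_measurable (restrict_space (borel \<Otimes>\<^sub>M borel) offdiag) \<and>
     bounded (h ` offdiag)"

text \<open>Norms are \<open>ennreal\<close>-valued so that the supremum over an empty \<open>offdiag\<close> (one-point space)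
  is 0.\<close>

definition sup_norm :: "('s \<times> 's \<Rightarrow> real) \<Rightarrow> ennreal" where
  "sup_norm h = (SUP z\<in>offdiag. ennreal \<bar>h z\<bar>)"

definition op_norm ::
  "(('s::topological_space \<times> 's \<Rightarrow> real) \<Rightarrow> 's \<times> 's \<Rightarrow> real) \<Rightarrow> ennreal" where
  "op_norm T = (SUP h\<in>{h. bdd_meas h \<and> sup_norm h \<le> 1}. sup_norm (T h))"

definition spec_rad ::
  "(('s::topological_space \<times> 's \<Rightarrow> real) \<Rightarrow> 's \<times> 's \<Rightarrow> real) \<Rightarrow> real" where
  "spec_rad T = lim (\<lambda>n. root n (enn2real (op_norm (T ^^ n))))"

definition eln :: "real \<Rightarrow> ereal" where
  "eln t = (if t = 0 then -\<infinity> else ereal (ln t))"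

end

theory Submission
  imports Defs
begin

text \<open>For bounded Borel \<open>f\<close> put \<open>D f (x, x') = f x - f x'\<close>. The common part of \<open>P x\<close> and
  \<open>P x'\<close> cancels in \<open>\<integral> f dP x - \<integral> f dP x'\<close>, so \<open>V (D f) = D (P f)\<close> exactly, and hence
  \<open>V^n (D f) = D (P^n f)\<close>. For an indicator \<open>f\<close>, positivity of \<open>V\<close> bounds the left side by
  \<open>V^n 1\<close>, and integrating the second variable against the stationary measure gives the first
  inequality without constructing a coupling. Positivity also gives \<open>\<parallel>V^n\<parallel> = sup V^n 1\<close>, which is
  submultiplicative, so the limit defining the spectral radius exists (Fekete) and the second
  inequality follows.\<close>

section \<open>Roots of submultiplicative sequences\<close>

text \<open>Fekete's argument in multiplicative form: the limit is the infimum of the roots. Writing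
  \<open>n = q * m + s\<close> with \<open>s < m\<close> bounds \<open>a n\<close> by the
  \<open>q\<close>-th power of a bound on \<open>a m\<close>, since
  \<open>a s \<le> 1\<close>.\<close>

lemma submult_root_convergent:
  fixes a :: "nat \<Rightarrow> real"
  assumes nonneg: "\<And>n. 0 \<le> a n" and le1: "\<And>n. a n \<le> 1"
    and submult: "\<And>m n. a (m + n) \<le> a m * a n"
  shows "convergent (\<lambda>n. root n (a n))"
proof -
  \<comment> \<open>Index 0 is left out because \<open>root 0\<close> is constantly 0.\<close>
  define r where "r = (INF n\<in>{1..}. root n (a n))"
  have bdd: "bdd_below ((\<lambda>n. root n (a n)) ` {1..})"
    by (rule bdd_belowI2[where m = 0]) (simp add: nonneg)
  have r_le: "r \<le> root n (a n)" if "n \<ge> 1" for n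
    unfolding r_def using that by (intro cINF_lower[OF bdd]) auto
  have "eventually (\<lambda>n. root n (a n) < u) sequentially" if "r < u" for u
  proof -
    from that obtain m where m: "m \<ge> 1" "root m (a m) < u"
      unfolding r_def using cINF_less_iff[OF _ bdd, of u] by auto
    \<comment> \<open>A value strictly above the root is positive even when \<open>a m = 0\<close>,
      so \<open>c\<close> can serve as a base of \<open>powr\<close>.\<close>
    obtain c where c: "root m (a m) < c" "c < u"
      using m(2) dense by blast
    have c0: "0 < c"
      using c(1) nonneg[of m] m(1) by (meson order.strict_trans1 real_root_ge_zero)
    have am: "a m \<le> c ^ m"
      using m(1) c(1) nonneg[of m] c0
      by (metis less_eq_real_def less_le_trans real_root_ge_zero real_root_pow_pos2 power_mono zero_less_one)
    have powers: "a (q * m + s) \<le> (c ^ m) ^ q" for q s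
    proof (induction q)
      case 0
      then show ?case using le1 by simp
    next
      case (Suc q)
      have "a (Suc q * m + s) \<le> a m * a (q * m + s)"
        using submult[of m "q * m + s"] by (simp add: algebra_simps)
      also have "\<dots> \<le> c ^ m * (c ^ m) ^ q"
        using am Suc nonneg c0 by (intro mult_mono) auto
      finally show ?case by simp
    qed
    \<comment> \<open>Replacing the exponent \<open>m * (n div m)\<close> by \<open>n\<close> costs
      a factor bounded independently of \<open>n\<close>, whose \<open>n\<close>-th root tends to
      1.\<close>
    have bound: "root n (a n) \<le> max 1 (1 / c) powr (m / n) * c" if "n \<ge> 1" for n
    proof -
      have "a n \<le> (c ^ m) ^ (n div m)"
        using powers[of "n div m" "n mod m"] by simp
      also have "\<dots> = c powr (real n - real (n mod m))"
      proof -
        have "real n - real (n mod m) = real (m * (n div m))"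
          by (metis add_diff_cancel_right' mult_div_mod_eq of_nat_add)
        then show ?thesis using c0 by (simp only: powr_realpow power_mult)
      qed
      also have "\<dots> = (1 / c) powr (n mod m) * c powr n"
        using c0 by (simp add: powr_diff powr_divide)
      also have "\<dots> \<le> max 1 (1 / c) powr m * c powr n"
      proof (intro mult_right_mono)
        have "(1 / c) powr (n mod m) \<le> max 1 (1 / c) powr (n mod m)"
          using c0 by (intro powr_mono2) auto
        also have "\<dots> \<le> max 1 (1 / c) powr m"
          using m(1) by (intro powr_mono) auto
        finally show "(1 / c) powr (n mod m) \<le> max 1 (1 / c) powr m" .
      qed simp
      finally have "root n (a n) \<le> root n (max 1 (1 / c) powr m * c powr n)"
        using that by simp
      also have "\<dots> = max 1 (1 / c) powr (m / n) * c"
        using that c0 by (simp add: root_powr_inverse powr_mult powr_powr)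
      finally show ?thesis .
    qed
    have "(\<lambda>n. max 1 (1 / c) powr (m / real n) * c) \<longlonglongrightarrow> max 1 (1 / c) powr 0 * c"
      by (intro tendsto_intros lim_const_over_n) auto
    moreover have "max 1 (1 / c) powr 0 * c < u"
      using c(2) by (simp add: max_def)
    ultimately have "eventually (\<lambda>n. max 1 (1 / c) powr (m / real n) * c < u) sequentially"
      by (rule order_tendstoD(2))
    then show ?thesis
      using eventually_ge_at_top[of 1]
      by eventually_elim (use bound in force)
  qed
  moreover have "eventually (\<lambda>n. l < root n (a n)) sequentially" if "l < r" for l
    using eventually_ge_at_top[of 1] by eventually_elim (use r_le that in force)
  ultimately have "(\<lambda>n. root n (a n)) \<longlonglongrightarrow> r"
    by (intro order_tendstoI)
  then show ?thesis by (rule convergentI)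
qed

section \<open>The logarithm with value minus infinity at zero\<close>

lemma eln_mono: "0 \<le> s \<Longrightarrow> s \<le> t \<Longrightarrow> eln s \<le> eln t"
  by (auto simp: eln_def)

text \<open>For \<open>t = 0\<close> both sides are minus infinity. At \<open>n = 0\<close> the two
  sides differ: the left is 0, the right is \<open>eln 0\<close>.\<close>

lemma eln_root: "0 \<le> t \<Longrightarrow> 1 \<le> n \<Longrightarrow> ereal (1 / real n) * eln t = eln (root n t)"
  by (auto simp: eln_def ln_root)

text \<open>For \<open>s \<ge> 0\<close>, \<open>eln s\<close> lies below a real \<open>v\<close>
  exactly if \<open>s < exp v\<close>. This covers the limit \<open>r = 0\<close> too, where the
  logarithms must tend to minus infinity.\<close>

lemma limsup_eln_le:
  assumes lim: "f \<longlonglongrightarrow> r" and nonneg: "\<And>n. 0 \<le> f n"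
  shows "limsup (\<lambda>n. eln (f n)) \<le> eln r"
  unfolding Limsup_le_iff
proof (intro allI impI)
  fix y assume y: "eln r < y"
  have r0: "0 \<le> r"
    using lim nonneg by (simp add: LIMSEQ_le_const)
  show "eventually (\<lambda>n. eln (f n) < y) sequentially"
  proof (cases y)
    case (real v)
    have "r < exp v"
    proof (cases "r = 0")
      case False
      then have "ln r < v" using y real by (simp add: eln_def)
      then show ?thesis using False r0 by (metis exp_less_cancel_iff exp_ln less_eq_real_def)
    qed simp
    then have "eventually (\<lambda>n. f n < exp v) sequentially"
      using lim order_tendstoD(2) by blast
    then show ?thesis
    proof eventually_elim
      case (elim n)
      show ?case
      proof (cases "f n = 0")
        case False
        then have "0 < f n" using nonneg[of n] by simp
        then have "ln (f n) < v" using elim by (metis ln_exp ln_less_cancel_iff exp_gt_zero)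
        then show ?thesis using False real by (simp add: eln_def)
      qed (simp add: eln_def real)
    qed
  next
    case PInf
    then show ?thesis by (simp add: eln_def)
  next
    case MInf
    then show ?thesis using y by simp
  qed
qed

section \<open>Bounded measurable functions off the diagonal\<close>

lemma bdd_meas_const: "bdd_meas (\<lambda>_. c)"
  by (auto simp: bdd_meas_def bounded_iff)

lemma bdd_meas_cmult: "bdd_meas h \<Longrightarrow> bdd_meas (\<lambda>z. c * h z)"
  using bounded_scaleR_comp[of h offdiag c] by (auto simp: bdd_meas_def)

lemma bdd_meas_diff:
  assumes [measurable]: "f \<in> borel_measurable borel" and B: "\<And>y. \<bar>f y\<bar> \<le> B"
  shows "bdd_meas (\<lambda>(u, v). f u - f v)"
  unfolding bdd_meas_def
proof
  show "(\<lambda>(u, v). f u - f v) \<in> borel_measurable (restrict_space (borel \<Otimes>\<^sub>M borel) offdiag)"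
    by (rule measurable_restrict_space1) measurable
  have "\<bar>f u - f v\<bar> \<le> 2 * B" for u v
    using B[of u] B[of v] by linarith
  then show "bounded ((\<lambda>(u, v). f u - f v) ` offdiag)"
    by (auto simp: bounded_iff intro!: exI[of _ "2 * B"])
qed

section \<open>Densities with respect to the dominating measure\<close>

text \<open>On a general topological space the diagonal may fail to be product measurable. The
  densities are chosen separately for each pair, so preservation of measurability by
  \<open>V_op P\<close> is a hypothesis as well.\<close>

locale coupled_chain =
  fixes P :: "'s::topological_space \<Rightarrow> 's measure"
  assumes kernel: "markov_kernel P"
    and diag_sets: "(Id :: ('s \<times> 's) set) \<in> sets (borel \<Otimes>\<^sub>M borel)"
    and bdd_meas_V: "\<And>h. bdd_meas h \<Longrightarrow> bdd_meas (V_op P h)"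
begin

lemma kernel_measurable: "P \<in> borel \<rightarrow>\<^sub>M prob_algebra borel"
  using kernel by (simp add: markov_kernel_def)

lemma kernel_measurable_subprob [measurable]: "P \<in> borel \<rightarrow>\<^sub>M subprob_algebra borel"
  by (rule measurable_prob_algebraD[OF kernel_measurable])

lemma prob_space_P: "prob_space (P x)" and sets_P [measurable_cong, simp]: "sets (P x) = sets borel"
  using measurable_space[OF kernel_measurable, of x] by (auto simp: space_prob_algebra)

lemma space_P [simp]: "space (P x) = UNIV"
  using sets_eq_imp_space_eq[OF sets_P] by simp

lemma sets_Lam [measurable_cong, simp]: "sets (Lam P x x') = sets borel"
  using sets.sigma_sets_eq[of "P x"] unfolding Lam_def add_measure_def
  by (simp add: sets.space_closed)

lemma space_Lam [simp]: "space (Lam P x x') = UNIV"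
  using sets_eq_imp_space_eq[OF sets_Lam] by simp

lemma emeasure_Lam:
  "A \<in> sets borel \<Longrightarrow> emeasure (Lam P x x') A = emeasure (P x) A + emeasure (P x') A"
  unfolding Lam_def by (intro emeasure_add_measure) auto

lemma finite_measure_Lam: "finite_measure (Lam P x x')"
proof
  have "emeasure (P z) UNIV = 1" for z
    using prob_space.emeasure_space_1[OF prob_space_P, of z] by simp
  then show "emeasure (Lam P x x') (space (Lam P x x')) \<noteq> \<infinity>"
    by (simp add: emeasure_Lam)
qed

lemma absolutely_continuous_Lam:
  "z \<in> {x, x'} \<Longrightarrow> absolutely_continuous (Lam P x x') (P z)"
  by (auto simp: absolutely_continuous_def null_sets_def emeasure_Lam)

lemma dens_measurable [measurable]: "dens P x x' z \<in> borel_measurable borel"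
proof -
  have "dens P x x' z \<in> borel_measurable (Lam P x x')"
    unfolding dens_def by measurable
  then show ?thesis by (simp add: measurable_cong_sets[OF sets_Lam refl])
qed

lemma min_dens_measurable [measurable]: "min_dens P x x' \<in> borel_measurable borel"
  unfolding min_dens_def by measurable

lemma dens_nonneg: "0 \<le> dens P x x' z y"
  by (simp add: dens_def)

lemma min_dens_nonneg: "0 \<le> min_dens P x x' y"
  by (simp add: min_dens_def dens_nonneg)

lemma min_dens_le: "z \<in> {x, x'} \<Longrightarrow> min_dens P x x' y \<le> dens P x x' z y"
  by (auto simp: min_dens_def)

text \<open>\<open>Lam P x x'\<close> is finite and dominates \<open>P z\<close>, so Radon-Nikodym
  applies. Integrals against \<open>P x\<close> and \<open>P x'\<close> become integrals over one
  measure, where the common part can be subtracted pointwise.\<close>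

lemma
  assumes z: "z \<in> {x, x'}" and f: "f \<in> borel_measurable borel"
  shows integrable_dens: "integrable (P z) f \<longleftrightarrow> integrable (Lam P x x') (\<lambda>y. dens P x x' z y * f y)"
    and integral_dens: "integral\<^sup>L (P z) f = (\<integral>y. dens P x x' z y * f y \<partial>Lam P x x')"
proof -
  interpret L: finite_measure "Lam P x x'" by (rule finite_measure_Lam)
  have N: "sigma_finite_measure (P z)"
    by (intro prob_space_imp_sigma_finite prob_space_P)
  have f': "f \<in> borel_measurable (Lam P x x')" using f by simp
  note * = N absolutely_continuous_Lam[OF z] _ f'
  show "integrable (P z) f \<longleftrightarrow> integrable (Lam P x x') (\<lambda>y. dens P x x' z y * f y)"
    unfolding dens_def by (rule L.RN_deriv_integrable[OF *]) simp
  show "integral\<^sup>L (P z) f = (\<integral>y. dens P x x' z y * f y \<partial>Lam P x x')"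
    unfolding dens_def by (rule L.RN_deriv_integral[OF *]) simp
qed

lemma integrable_P:
  fixes f :: "'s \<Rightarrow> real"
  assumes "f \<in> borel_measurable borel" "\<And>y. \<bar>f y\<bar> \<le> B"
  shows "integrable (P z) f"
proof -
  interpret prob_space "P z" by (rule prob_space_P)
  show ?thesis by (rule integrable_const_bound[of _ B]) (use assms in auto)
qed

lemma
  assumes z: "z \<in> {x, x'}"
  shows integrable_dens_1: "integrable (Lam P x x') (dens P x x' z)"
    and integral_dens_1: "integral\<^sup>L (Lam P x x') (dens P x x' z) = 1"
proof -
  interpret prob_space "P z" by (rule prob_space_P)
  have one: "(\<lambda>_. 1 :: real) \<in> borel_measurable (borel :: 's measure)" by simp
  show "integrable (Lam P x x') (dens P x x' z)"
    using iffD1[OF integrable_dens[OF z one] integrable_const] by simp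
  show "integral\<^sup>L (Lam P x x') (dens P x x' z) = 1"
    using integral_dens[OF z one] prob_space by simp
qed

lemma integrable_min_dens: "integrable (Lam P x x') (min_dens P x x')"
proof (rule Bochner_Integration.integrable_bound[OF integrable_dens_1[of x]])
  show "AE y in Lam P x x'. norm (min_dens P x x' y) \<le> norm (dens P x x' x y)"
    using min_dens_le[of x x x'] min_dens_nonneg[of x x'] dens_nonneg[of x x' x] by (intro AE_I2) simp
qed auto

lemma kappa_le_1: "kappa P x x' \<le> 1"
proof -
  have "kappa P x x' \<le> integral\<^sup>L (Lam P x x') (dens P x x' x)"
    unfolding kappa_def by (intro integral_mono integrable_min_dens integrable_dens_1 min_dens_le) auto
  then show ?thesis by (simp add: integral_dens_1)
qed

lemma kappa_nonneg: "0 \<le> kappa P x x'"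
  unfolding kappa_def by (rule integral_nonneg_AE) (simp add: min_dens_nonneg)

text \<open>The nonnegative function \<open>dens - min_dens\<close> has integral
  \<open>1 - kappa = 0\<close>, hence vanishes almost everywhere. The right side is the same for
  \<open>z = x\<close> and \<open>z = x'\<close>, which matches the value 0 of \<open>V_op\<close>
  when \<open>kappa\<close> is 1.\<close>

lemma integral_kappa_1:
  assumes z: "z \<in> {x, x'}" and k: "kappa P x x' = 1" and f: "f \<in> borel_measurable borel"
  shows "integral\<^sup>L (P z) f = (\<integral>y. min_dens P x x' y * f y \<partial>Lam P x x')"
proof -
  have "(\<integral>y. dens P x x' z y - min_dens P x x' y \<partial>Lam P x x') = 0"
    using k integral_dens_1[OF z] integrable_dens_1[OF z] integrable_min_dens[of x x']
    by (simp add: kappa_def)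
  then have "AE y in Lam P x x'. dens P x x' z y - min_dens P x x' y = 0"
    using integrable_dens_1[OF z] integrable_min_dens[of x x'] min_dens_le[OF z]
    by (subst integral_nonneg_eq_0_iff_AE[symmetric]) auto
  then show ?thesis
    unfolding integral_dens[OF z f] by (intro integral_cong_AE) (use f in auto)
qed

section \<open>The normalized excess over the common part\<close>

text \<open>One form for both factors: \<open>z = x\<close> gives \<open>Q1 P x x'\<close> and
  \<open>z = x'\<close> gives \<open>Q2 P x x'\<close>.\<close>

definition excess :: "'s \<Rightarrow> 's \<Rightarrow> 's \<Rightarrow> 's measure" where
  "excess x x' z = density (Lam P x x')
     (\<lambda>u. ennreal ((dens P x x' z u - min_dens P x x' u) / (1 - kappa P x x')))"

lemma sets_excess [measurable_cong, simp]: "sets (excess x x' z) = sets borel"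
  by (simp add: excess_def)

lemma space_excess [simp]: "space (excess x x' z) = UNIV"
  by (simp add: excess_def)

text \<open>The subtracted integral does not depend on \<open>z\<close>, so it cancels when the
  identities for \<open>z = x\<close> and \<open>z = x'\<close> are subtracted. Integrability of
  \<open>min_dens * f\<close> comes from domination by \<open>dens * f\<close>.\<close>

lemma
  fixes f :: "'s \<Rightarrow> real"
  assumes z: "z \<in> {x, x'}" and k: "kappa P x x' \<noteq> 1"
    and f[measurable]: "f \<in> borel_measurable borel" and B: "\<And>y. \<bar>f y\<bar> \<le> B"
  shows integrable_excess: "integrable (excess x x' z) f"
    and integral_excess: "(1 - kappa P x x') * integral\<^sup>L (excess x x' z) f =
       integral\<^sup>L (P z) f - (\<integral>y. min_dens P x x' y * f y \<partial>Lam P x x')"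
proof -
  have k1: "kappa P x x' < 1" using k kappa_le_1[of x x'] by simp
  have nn: "AE u in Lam P x x'. 0 \<le> (dens P x x' z u - min_dens P x x' u) / (1 - kappa P x x')"
    using k1 min_dens_le[OF z] by auto
  have df: "integrable (Lam P x x') (\<lambda>y. dens P x x' z y * f y)"
    using integrable_P[OF f B] integrable_dens[OF z f] by simp
  have mf: "integrable (Lam P x x') (\<lambda>y. min_dens P x x' y * f y)"
  proof (rule Bochner_Integration.integrable_bound[OF df])
    show "AE y in Lam P x x'. norm (min_dens P x x' y * f y) \<le> norm (dens P x x' z y * f y)"
      using min_dens_le[OF z] min_dens_nonneg[of x x'] dens_nonneg[of x x' z]
      by (intro AE_I2) (simp add: abs_mult mult_right_mono)
  qed auto
  have eq: "(\<lambda>u. ((dens P x x' z u - min_dens P x x' u) / (1 - kappa P x x')) *\<^sub>R f u) =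
    (\<lambda>u. (dens P x x' z u * f u - min_dens P x x' u * f u) / (1 - kappa P x x'))"
    by (auto simp: field_simps)
  show "integrable (excess x x' z) f"
    unfolding excess_def
  proof (subst integrable_density[OF _ _ nn])
    show "integrable (Lam P x x')
      (\<lambda>u. ((dens P x x' z u - min_dens P x x' u) / (1 - kappa P x x')) *\<^sub>R f u)"
      unfolding eq using df mf by (intro integrable_divide Bochner_Integration.integrable_diff)
  qed measurable
  have "integral\<^sup>L (excess x x' z) f =
    (\<integral>u. (dens P x x' z u * f u - min_dens P x x' u * f u) / (1 - kappa P x x') \<partial>Lam P x x')"
    unfolding excess_def eq[symmetric] by (rule integral_density[OF _ _ nn]) measurable
  then show "(1 - kappa P x x') * integral\<^sup>L (excess x x' z) f =
       integral\<^sup>L (P z) f - (\<integral>y. min_dens P x x' y * f y \<partial>Lam P x x')"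
    using df mf k1 by (simp add: integral_dens[OF z f])
qed

lemma prob_space_excess:
  assumes z: "z \<in> {x, x'}" and k: "kappa P x x' \<noteq> 1"
  shows "prob_space (excess x x' z)"
proof -
  \<comment> \<open>Integrability of the constant 1 yields finiteness of the total mass, which is
    then computed from \<open>integral_excess\<close> with \<open>f = 1\<close>.\<close>
  have int: "integrable (excess x x' z) (\<lambda>_. 1::real)"
    by (rule integrable_excess[OF z k, where B = 1]) auto
  then interpret finite_measure "excess x x' z"
    by (auto simp: integrable_iff_bounded intro!: finite_measureI)
  have "(1 - kappa P x x') * measure (excess x x' z) UNIV = 1 - kappa P x x'"
    using integral_excess[OF z k, of "\<lambda>_. 1" 1] prob_space.prob_space[OF prob_space_P, of z]
    by (simp add: kappa_def)
  then have "measure (excess x x' z) UNIV = 1" using k by simp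
  then show ?thesis
    by (intro prob_spaceI) (simp add: emeasure_eq_measure)
qed

section \<open>One-step law of the uncoupled pair\<close>

lemma offdiag_sets: "offdiag \<in> sets (borel \<Otimes>\<^sub>M borel :: ('s \<times> 's) measure)"
proof -
  have "space (borel \<Otimes>\<^sub>M borel :: ('s \<times> 's) measure) - Id \<in> sets (borel \<Otimes>\<^sub>M borel)"
    using diag_sets by blast
  then show ?thesis by (simp add: offdiag_def space_pair_measure Compl_eq_Diff_UNIV)
qed

lemma hat_kernel_eq:
  "hat_kernel P (x, x') = restrict_space (excess x x' x \<Otimes>\<^sub>M excess x x' x') offdiag"
  by (simp add: hat_kernel_def Q1_def Q2_def excess_def)

lemma sets_excess_pair:
  "sets (excess x x' x \<Otimes>\<^sub>M excess x x' x') = sets (borel \<Otimes>\<^sub>M borel)"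
  by (intro sets_pair_measure_cong) auto

lemma sets_hat_kernel:
  "sets (hat_kernel P (x, x')) = sets (restrict_space (borel \<Otimes>\<^sub>M borel) offdiag)"
  unfolding hat_kernel_eq by (intro sets_restrict_space_cong sets_excess_pair)

lemma space_hat_kernel: "space (hat_kernel P (x, x')) = offdiag"
  by (simp add: hat_kernel_eq space_restrict_space space_pair_measure)

text \<open>Restricting a product of two probability measures to a measurable set cannot increase
  its mass.\<close>

lemma
  assumes k: "kappa P x x' \<noteq> 1"
  shows finite_hat_kernel: "finite_measure (hat_kernel P (x, x'))"
    and measure_hat_kernel_le: "measure (hat_kernel P (x, x')) offdiag \<le> 1"
proof -
  interpret A: prob_space "excess x x' x" by (rule prob_space_excess) (use k in auto)
  interpret B: prob_space "excess x x' x'" by (rule prob_space_excess) (use k in auto)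
  interpret AB: pair_prob_space "excess x x' x" "excess x x' x'" ..
  show "finite_measure (hat_kernel P (x, x'))"
    unfolding hat_kernel_eq
    by (intro finite_measure_restrict_space AB.P.finite_measure_axioms)
      (simp add: sets_excess_pair offdiag_sets space_pair_measure)
  show "measure (hat_kernel P (x, x')) offdiag \<le> 1"
    unfolding hat_kernel_eq
    by (subst measure_restrict_space) (auto simp: sets_excess_pair offdiag_sets space_pair_measure)
qed

lemma integrable_hat_kernel:
  assumes k: "kappa P x x' \<noteq> 1" and h: "bdd_meas h"
  shows "integrable (hat_kernel P (x, x')) h"
proof -
  interpret finite_measure "hat_kernel P (x, x')" by (rule finite_hat_kernel[OF k])
  obtain B where B: "\<And>z. z \<in> offdiag \<Longrightarrow> \<bar>h z\<bar> \<le> B"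
    using h by (auto simp: bdd_meas_def bounded_iff)
  show ?thesis
  proof (rule integrable_const_bound[of _ B])
    show "AE z in hat_kernel P (x, x'). norm (h z) \<le> B"
      by (rule AE_I2) (simp add: space_hat_kernel B)
    show "h \<in> borel_measurable (hat_kernel P (x, x'))"
      using h by (simp add: bdd_meas_def measurable_cong_sets[OF sets_hat_kernel refl])
  qed
qed

section \<open>Positivity of the operator and its action on differences\<close>

text \<open>\<open>V_op P\<close> integrates against a measure and multiplies by
  \<open>1 - kappa \<ge> 0\<close>. In the degenerate cases both sides are 0.\<close>

lemma V_mono:
  assumes h: "bdd_meas h" and k: "bdd_meas k" and le: "\<And>z. z \<in> offdiag \<Longrightarrow> h z \<le> k z"
  shows "V_op P h z \<le> V_op P k z"
proof (cases z)
  case (Pair x x')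
  show ?thesis
  proof (cases "x = x' \<or> kappa P x x' = 1")
    case False
    then have "integral\<^sup>L (hat_kernel P (x, x')) h \<le> integral\<^sup>L (hat_kernel P (x, x')) k"
      by (intro integral_mono integrable_hat_kernel h k le) (auto simp: space_hat_kernel)
    then show ?thesis
      using False kappa_le_1[of x x'] by (simp add: Pair V_op_def mult_left_mono)
  qed (auto simp: Pair V_op_def)
qed

lemma V_cmult: "V_op P (\<lambda>z. c * h z) = (\<lambda>z. c * V_op P h z)"
  by (auto simp: V_op_def fun_eq_iff)

text \<open>The integrand vanishes on the diagonal, so restricting to \<open>offdiag\<close> does not change the
  integral, and mutual singularity of the two factors is not needed.\<close>

lemma V_diff:
  assumes f[measurable]: "f \<in> borel_measurable borel" and B: "\<And>y. \<bar>f y\<bar> \<le> B"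
  shows "V_op P (\<lambda>(u, v). f u - f v) = (\<lambda>(x, x'). integral\<^sup>L (P x) f - integral\<^sup>L (P x') f)"
proof (rule ext, clarify)
  fix x x'
  consider "x = x'" | "x \<noteq> x'" "kappa P x x' = 1" | "x \<noteq> x'" "kappa P x x' \<noteq> 1" by blast
  then show "V_op P (\<lambda>(u, v). f u - f v) (x, x') = integral\<^sup>L (P x) f - integral\<^sup>L (P x') f"
  proof cases
    case 1
    then show ?thesis by (simp add: V_op_def)
  next
    \<comment> \<open>The integrals against \<open>P x\<close> and \<open>P x'\<close> both equal
      the integral against the common part, so their difference is 0.\<close>
    case 2
    then show ?thesis
      using integral_kappa_1[OF _ 2(2) f, of x] integral_kappa_1[OF _ 2(2) f, of x']
      by (simp add: V_op_def)
  next
    case 3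
    interpret A: prob_space "excess x x' x" by (rule prob_space_excess) (use 3 in auto)
    interpret B: prob_space "excess x x' x'" by (rule prob_space_excess) (use 3 in auto)
    interpret AB: pair_prob_space "excess x x' x" "excess x x' x'" ..
    have fA: "integrable (excess x x' x) f" and fB: "integrable (excess x x' x') f"
      by (rule integrable_excess[OF _ 3(2) f B]; simp)+
    have "(\<integral>z. (case z of (u, v) \<Rightarrow> f u - f v) \<partial>hat_kernel P (x, x')) =
      (\<integral>z. indicator offdiag z *\<^sub>R (case z of (u, v) \<Rightarrow> f u - f v) \<partial>(excess x x' x \<Otimes>\<^sub>M excess x x' x'))"
      unfolding hat_kernel_eq
      by (subst integral_restrict_space) (auto simp: sets_excess_pair offdiag_sets space_pair_measure)
    also have "\<dots> = (\<integral>z. (case z of (u, v) \<Rightarrow> f u - f v) \<partial>(excess x x' x \<Otimes>\<^sub>M excess x x' x'))"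
      by (intro Bochner_Integration.integral_cong) (auto simp: offdiag_def indicator_def)
    also have "\<dots> = (\<integral>u. \<integral>v. f u - f v \<partial>excess x x' x' \<partial>excess x x' x)"
    proof (subst AB.integral_fst'[symmetric])
      show "integrable (excess x x' x \<Otimes>\<^sub>M excess x x' x') (\<lambda>(u, v). f u - f v)"
      proof (rule AB.integrable_const_bound[of _ "2 * B"])
        have "\<bar>f u - f v\<bar> \<le> 2 * B" for u v
          using B[of u] B[of v] by linarith
        then show "AE z in excess x x' x \<Otimes>\<^sub>M excess x x' x'. norm (case z of (u, v) \<Rightarrow> f u - f v) \<le> 2 * B"
          by auto
      qed measurable
    qed simp
    also have "\<dots> = integral\<^sup>L (excess x x' x) f - integral\<^sup>L (excess x x' x') f"
      using fA fB A.prob_space B.prob_space by simp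
    finally have "V_op P (\<lambda>(u, v). f u - f v) (x, x') =
      (1 - kappa P x x') * integral\<^sup>L (excess x x' x) f - (1 - kappa P x x') * integral\<^sup>L (excess x x' x') f"
      using 3 by (simp add: V_op_def right_diff_distrib)
    \<comment> \<open>The two instances of \<open>integral_excess\<close> share the
      \<open>min_dens\<close> integral, which cancels.\<close>
    also have "\<dots> = integral\<^sup>L (P x) f - integral\<^sup>L (P x') f"
      by (simp add: integral_excess[OF _ 3(2) f B])
    finally show ?thesis .
  qed
qed

section \<open>Powers of the operator\<close>

lemma bdd_meas_V_pow: "bdd_meas h \<Longrightarrow> bdd_meas ((V_op P ^^ n) h)"
  by (induction n) (auto intro: bdd_meas_V)

lemma V_pow_mono:
  assumes "bdd_meas h" "bdd_meas k" "\<And>z. z \<in> offdiag \<Longrightarrow> h z \<le> k z" "z \<in> offdiag"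
  shows "(V_op P ^^ n) h z \<le> (V_op P ^^ n) k z"
  using assms(4)
proof (induction n arbitrary: z)
  case (Suc n)
  show ?case
    unfolding funpow.simps comp_def
    by (intro V_mono bdd_meas_V_pow assms(1,2) Suc.IH)
qed (simp add: assms)

lemma V_pow_cmult: "(V_op P ^^ n) (\<lambda>z. c * h z) = (\<lambda>z. c * (V_op P ^^ n) h z)"
  by (induction n) (auto simp: V_cmult)

text \<open>Monotonicity applied to \<open>h \<le> 1\<close> and to \<open>-h \<le> 1\<close>. The
  negation is written as multiplication by \<open>- 1\<close> so that homogeneity pulls it
  out.\<close>

lemma V_pow_abs_le:
  assumes h: "bdd_meas h" and le: "\<And>z. z \<in> offdiag \<Longrightarrow> \<bar>h z\<bar> \<le> 1" and z: "z \<in> offdiag"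
  shows "\<bar>(V_op P ^^ n) h z\<bar> \<le> (V_op P ^^ n) (\<lambda>_. 1) z"
proof -
  have "(V_op P ^^ n) h z \<le> (V_op P ^^ n) (\<lambda>_. 1) z"
    by (rule V_pow_mono[OF h bdd_meas_const _ z]) (use le in force)
  moreover
  have "(V_op P ^^ n) (\<lambda>z. - 1 * h z) z \<le> (V_op P ^^ n) (\<lambda>_. 1) z"
    by (rule V_pow_mono[OF bdd_meas_cmult[OF h] bdd_meas_const _ z]) (use le in force)
  then have "- 1 * (V_op P ^^ n) h z \<le> (V_op P ^^ n) (\<lambda>_. 1) z"
    by (simp only: V_pow_cmult)
  ultimately show ?thesis by simp
qed

lemma V_pow_1_nonneg: "z \<in> offdiag \<Longrightarrow> 0 \<le> (V_op P ^^ n) (\<lambda>_. 1) z"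
  using V_pow_abs_le[OF bdd_meas_const[of 0], of z n] by simp

lemma V_1_le: "V_op P (\<lambda>_. 1) (x, x') \<le> 1"
proof (cases "x = x' \<or> kappa P x x' = 1")
  case False
  have "(1 - kappa P x x') * measure (hat_kernel P (x, x')) offdiag \<le> 1 * 1"
    using False kappa_le_1[of x x'] kappa_nonneg[of x x']
    by (intro mult_mono measure_hat_kernel_le) auto
  then show ?thesis using False by (simp add: V_op_def space_hat_kernel)
qed (auto simp: V_op_def)

lemma V_pow_1_le: "z \<in> offdiag \<Longrightarrow> (V_op P ^^ n) (\<lambda>_. 1) z \<le> 1"
proof (induction n arbitrary: z)
  case (Suc n)
  have "(V_op P ^^ Suc n) (\<lambda>_. 1) z \<le> V_op P (\<lambda>_. 1) z"
    unfolding funpow.simps comp_def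
    by (intro V_mono bdd_meas_V_pow bdd_meas_const Suc.IH)
  also have "\<dots> \<le> 1" by (cases z) (simp add: V_1_le)
  finally show ?case .
qed simp

section \<open>Operator norm and spectral radius\<close>

text \<open>\<open>enn2real\<close> sends infinity to 0, so this is the true norm only because
  \<open>op_norm_le_1\<close> makes the norm finite.\<close>

definition V_norm :: "nat \<Rightarrow> real" where
  "V_norm n = enn2real (op_norm (V_op P ^^ n))"

lemma op_norm_le_1: "op_norm (V_op P ^^ n) \<le> 1"
  unfolding op_norm_def sup_norm_def
proof (intro SUP_least)
  fix h :: "'s \<times> 's \<Rightarrow> real" and z :: "'s \<times> 's"
  assume h: "h \<in> {h. bdd_meas h \<and> (SUP z\<in>offdiag. ennreal \<bar>h z\<bar>) \<le> 1}" and z: "z \<in> offdiag"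
  have "\<bar>h z\<bar> \<le> 1" if "z \<in> offdiag" for z
    using h that by (auto simp: SUP_le_iff)
  then have "\<bar>(V_op P ^^ n) h z\<bar> \<le> 1"
    using V_pow_abs_le[of h z n] V_pow_1_le[OF z, of n] h z by force
  then show "ennreal \<bar>(V_op P ^^ n) h z\<bar> \<le> 1" by simp
qed

lemma V_norm_le_1: "V_norm n \<le> 1"
  unfolding V_norm_def using enn2real_mono[OF op_norm_le_1[of n]] by simp

text \<open>The constant 1 belongs to the unit ball over which \<open>op_norm\<close> takes its
  supremum.\<close>

lemma V_pow_1_le_V_norm:
  assumes z: "z \<in> offdiag"
  shows "(V_op P ^^ n) (\<lambda>_. 1) z \<le> V_norm n"
proof -
  have "ennreal \<bar>(V_op P ^^ n) (\<lambda>_. 1) z\<bar> \<le> sup_norm ((V_op P ^^ n) (\<lambda>_. 1))"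
    unfolding sup_norm_def using z by (rule SUP_upper)
  also have "\<dots> \<le> op_norm (V_op P ^^ n)"
    unfolding op_norm_def by (rule SUP_upper) (auto simp: bdd_meas_const sup_norm_def SUP_le_iff)
  finally have "enn2real (ennreal \<bar>(V_op P ^^ n) (\<lambda>_. 1) z\<bar>) \<le> V_norm n"
    unfolding V_norm_def using op_norm_le_1[of n]
    by (intro enn2real_mono) (auto simp: le_less_trans)
  then show ?thesis by simp
qed

text \<open>By positivity the constant 1 is extremal in the unit ball. With the preceding bound,
  \<open>V_norm n\<close> is the supremum of \<open>V^n 1\<close> off the diagonal. If
  \<open>offdiag\<close> is empty the first premise is vacuous, hence the condition
  \<open>0 \<le> c\<close>.\<close>

lemma V_norm_leI:
  assumes "\<And>z. z \<in> offdiag \<Longrightarrow> (V_op P ^^ n) (\<lambda>_. 1) z \<le> c" "0 \<le> c"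
  shows "V_norm n \<le> c"
proof -
  have "op_norm (V_op P ^^ n) \<le> ennreal c"
    unfolding op_norm_def sup_norm_def
  proof (intro SUP_least)
    fix h :: "'s \<times> 's \<Rightarrow> real" and z :: "'s \<times> 's"
    assume h: "h \<in> {h. bdd_meas h \<and> (SUP z\<in>offdiag. ennreal \<bar>h z\<bar>) \<le> 1}" and z: "z \<in> offdiag"
    have "\<bar>h z\<bar> \<le> 1" if "z \<in> offdiag" for z
      using h that by (auto simp: SUP_le_iff)
    then have "\<bar>(V_op P ^^ n) h z\<bar> \<le> c"
      using V_pow_abs_le[of h z n] assms(1)[OF z] h z by force
    then show "ennreal \<bar>(V_op P ^^ n) h z\<bar> \<le> ennreal c" by (rule ennreal_leI)
  qed
  then show ?thesis
    unfolding V_norm_def using assms(2) by (simp add: enn2real_leI)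
qed

text \<open>Apply the positive operator \<open>V^m\<close> to the pointwise bound
  \<open>V^n 1 \<le> V_norm n * 1\<close>.\<close>

lemma V_norm_submult: "V_norm (m + n) \<le> V_norm m * V_norm n"
proof (rule V_norm_leI)
  fix z :: "'s \<times> 's" assume z: "z \<in> offdiag"
  have "(V_op P ^^ (m + n)) (\<lambda>_. 1) z = (V_op P ^^ m) ((V_op P ^^ n) (\<lambda>_. 1)) z"
    by (simp add: funpow_add)
  also have "\<dots> \<le> (V_op P ^^ m) (\<lambda>_. V_norm n * 1) z"
    by (rule V_pow_mono[OF _ _ _ z])
       (auto intro!: bdd_meas_V_pow bdd_meas_const V_pow_1_le_V_norm)
  also have "\<dots> = V_norm n * (V_op P ^^ m) (\<lambda>_. 1) z"
    by (simp only: V_pow_cmult)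
  also have "\<dots> \<le> V_norm n * V_norm m"
    using z by (intro mult_left_mono V_pow_1_le_V_norm) (auto simp: V_norm_def)
  finally show "(V_op P ^^ (m + n)) (\<lambda>_. 1) z \<le> V_norm m * V_norm n" by (simp add: mult.commute)
qed (simp add: V_norm_def)

text \<open>\<open>spec_rad\<close> is defined by \<open>lim\<close>, which is an actual limit only
  once convergence is known.\<close>

lemma V_norm_root_tendsto: "(\<lambda>n. root n (V_norm n)) \<longlonglongrightarrow> spec_rad (V_op P)"
proof -
  have "convergent (\<lambda>n. root n (V_norm n))"
    by (intro submult_root_convergent V_norm_submult V_norm_le_1) (simp add: V_norm_def)
  then show ?thesis
    unfolding spec_rad_def V_norm_def[symmetric] by (simp add: convergent_LIMSEQ_iff)
qed

section \<open>Iterated kernels and stationarity\<close>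

lemma nstep_measurable: "nstep P n \<in> borel \<rightarrow>\<^sub>M prob_algebra borel"
proof (induction n)
  case (Suc n)
  then show ?case by (simp add: measurable_bind_prob_space[OF _ kernel_measurable])
qed (simp add: measurable_return_prob_space)

lemma prob_space_nstep: "prob_space (nstep P n x)"
  and sets_nstep [measurable_cong, simp]: "sets (nstep P n x) = sets borel"
  using measurable_space[OF nstep_measurable, of x] by (auto simp: space_prob_algebra)

lemma integral_P_measurable:
  fixes f :: "'s \<Rightarrow> real"
  assumes f: "f \<in> borel_measurable borel"
  shows "(\<lambda>x. integral\<^sup>L (P x) f) \<in> borel_measurable borel"
  by (rule measurable_compose[OF kernel_measurable_subprob integral_measurable_subprob_algebra[OF f]])

text \<open>With \<open>integral_P_measurable\<close> this shows that averaging over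
  \<open>P\<close> keeps \<open>f\<close> Borel and bounded by the same \<open>B\<close>, so
  inductions on the number of steps may replace \<open>f\<close> by its average.\<close>

lemma abs_integral_P_le:
  fixes f :: "'s \<Rightarrow> real"
  assumes "f \<in> borel_measurable borel" "\<And>y. \<bar>f y\<bar> \<le> B"
  shows "\<bar>integral\<^sup>L (P x) f\<bar> \<le> B"
proof -
  interpret prob_space "P x" by (rule prob_space_P)
  have "\<bar>integral\<^sup>L (P x) f\<bar> \<le> (\<integral>y. \<bar>f y\<bar> \<partial>P x)" by (rule integral_abs_bound)
  also have "\<dots> \<le> (\<integral>y. B \<partial>P x)"
    using assms integrable_P[OF assms] by (intro integral_mono) auto
  finally show ?thesis using prob_space by simp
qed

lemma integral_bind_P:
  fixes f :: "'s \<Rightarrow> real"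
  assumes "prob_space M" "sets M = sets borel" "f \<in> borel_measurable borel" "\<And>y. \<bar>f y\<bar> \<le> B"
  shows "integral\<^sup>L (M \<bind> P) f = (\<integral>x. integral\<^sup>L (P x) f \<partial>M)"
proof -
  interpret prob_space M by fact
  note [measurable_cong] = assms(2)
  show ?thesis
    by (rule integral_bind[where K = borel and B = B and B' = 1])
      (use assms sets_eq_imp_space_eq[OF assms(2)] prob_space.emeasure_space_1[OF prob_space_P] in
        \<open>auto intro: finite_measure_axioms\<close>)
qed

text \<open>\<open>nstep\<close> appends the new step at the end, so
  \<open>P^(n+1) f = P^n (P f)\<close>. The induction hypothesis is used for \<open>P f\<close>, and
  \<open>funpow_swap1\<close> moves one application of the operator innermost, where
  \<open>V_diff\<close> turns the difference for \<open>f\<close> into that for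
  \<open>P f\<close>.\<close>

lemma nstep_diff_eq:
  assumes "f \<in> borel_measurable borel" "\<And>y. \<bar>f y\<bar> \<le> B"
  shows "(\<lambda>(x, x'). integral\<^sup>L (nstep P n x) f - integral\<^sup>L (nstep P n x') f) =
    (V_op P ^^ n) (\<lambda>(u, v). f u - f v)"
  using assms
proof (induction n arbitrary: f)
  case 0
  then show ?case by (auto simp: integral_return)
next
  case (Suc n)
  show ?case
    using Suc.IH[OF integral_P_measurable abs_integral_P_le, OF Suc.prems(1) Suc.prems]
    by (simp add: integral_bind_P[OF prob_space_nstep sets_nstep Suc.prems] funpow_swap1 V_diff[OF Suc.prems])
qed

text \<open>Turns the setwise invariance of the definition into an equality of measures, which
  transfers to integrals of bounded functions.\<close>

lemma stationary_bind:
  assumes st: "stationary P \<mu>"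
  shows "\<mu> \<bind> P = \<mu>"
proof -
  interpret prob_space \<mu> using st by (simp add: stationary_def)
  have \<mu>: "sets \<mu> = sets borel" "\<mu> \<in> space (prob_algebra borel)"
    using st by (auto simp: stationary_def space_prob_algebra)
  interpret bind: prob_space "\<mu> \<bind> P" by (rule prob_space_bind'[OF \<mu>(2) kernel_measurable])
  have bs: "sets (\<mu> \<bind> P) = sets borel" by (rule sets_bind'[OF \<mu>(2) kernel_measurable])
  have P\<mu>: "P \<in> \<mu> \<rightarrow>\<^sub>M subprob_algebra borel"
    using kernel_measurable_subprob by (simp add: measurable_cong_sets[OF \<mu>(1) refl])
  show ?thesis
  proof (rule measure_eqI)
    fix A assume "A \<in> sets (\<mu> \<bind> P)"
    then have A: "A \<in> sets borel" by (simp add: bs)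
    have "measure (\<mu> \<bind> P) A = measure \<mu> A"
      using st A measure_bind[OF P\<mu> A] by (simp add: stationary_def)
    then show "emeasure (\<mu> \<bind> P) A = emeasure \<mu> A"
      by (simp add: bind.emeasure_eq_measure emeasure_eq_measure)
  qed (simp add: bs \<mu>)
qed

lemma stationary_nstep:
  fixes f :: "'s \<Rightarrow> real"
  assumes st: "stationary P \<mu>" and f: "f \<in> borel_measurable borel" "\<And>y. \<bar>f y\<bar> \<le> B"
  shows "(\<integral>x. integral\<^sup>L (nstep P n x) f \<partial>\<mu>) = integral\<^sup>L \<mu> f"
  using f
proof (induction n arbitrary: f)
  case 0
  then show ?case by (simp add: integral_return)
next
  case (Suc n)
  have "(\<integral>x. integral\<^sup>L (nstep P (Suc n) x) f \<partial>\<mu>) = (\<integral>x. integral\<^sup>L (P x) f \<partial>\<mu>)"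
    using Suc.IH[OF integral_P_measurable abs_integral_P_le, OF Suc.prems(1) Suc.prems]
    by (simp add: integral_bind_P[OF prob_space_nstep sets_nstep Suc.prems])
  also have "\<dots> = integral\<^sup>L (\<mu> \<bind> P) f"
    by (rule integral_bind_P[symmetric, OF _ _ Suc.prems]) (use st in \<open>auto simp: stationary_def\<close>)
  finally show ?case by (simp add: stationary_bind[OF st])
qed

section \<open>Comparison with the stationary measure\<close>

lemma V_pow_1_section_integrable:
  assumes st: "stationary P \<mu>"
  shows "set_integrable \<mu> {x2. x2 \<noteq> x1} (\<lambda>x2. (V_op P ^^ n) (\<lambda>_. 1) (x1, x2))"
proof -
  interpret prob_space \<mu> using st by (simp add: stationary_def)
  have [measurable_cong]: "sets \<mu> = sets borel" using st by (simp add: stationary_def)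
  \<comment> \<open>\<open>bdd_meas\<close> gives measurability only on \<open>offdiag\<close>.
    Extension by 0 makes the function measurable on all pairs, so its sections are
    measurable.\<close>
  let ?g = "\<lambda>z. indicator offdiag z *\<^sub>R (V_op P ^^ n) (\<lambda>_. 1) z"
  have [measurable]: "?g \<in> borel_measurable (borel \<Otimes>\<^sub>M borel)"
    using bdd_meas_V_pow[OF bdd_meas_const[of 1], of n] offdiag_sets
    by (subst borel_measurable_restrict_space_iff[symmetric]) (auto simp: bdd_meas_def space_pair_measure)
  have eq: "(\<lambda>x2. indicator {x2. x2 \<noteq> x1} x2 *\<^sub>R (V_op P ^^ n) (\<lambda>_. 1) (x1, x2)) = (\<lambda>x2. ?g (x1, x2))"
    by (auto simp: offdiag_def indicator_def)
  show ?thesis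
    unfolding set_integrable_def eq
  proof (rule integrable_const_bound[of _ 1])
    show "AE x in \<mu>. norm (?g (x1, x)) \<le> 1"
      using V_pow_1_nonneg V_pow_1_le by (auto simp: indicator_def)
  qed measurable
qed

lemma nstep_stationary_diff_le:
  assumes st: "stationary P \<mu>" and A: "A \<in> sets borel"
  shows "\<bar>measure (nstep P n x1) A - measure \<mu> A\<bar>
    \<le> (LINT x2:{x2. x2 \<noteq> x1}|\<mu>. (V_op P ^^ n) (\<lambda>_. 1) (x1, x2))"
proof -
  interpret prob_space \<mu> using st by (simp add: stationary_def)
  have \<mu>[measurable_cong]: "sets \<mu> = sets borel" using st by (simp add: stationary_def)
  define f :: "'s \<Rightarrow> real" where "f = indicator A"
  have f: "f \<in> borel_measurable borel" "\<And>y. \<bar>f y\<bar> \<le> 1"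
    using A by (auto simp: f_def indicator_def)
  define g where "g x = integral\<^sup>L (nstep P n x) f" for x
  have g_eq: "g x = measure (nstep P n x) A" for x
    using A by (simp add: g_def f_def)
  note [measurable] = measurable_prob_algebraD[OF nstep_measurable] f(1)
  have g_meas: "g \<in> borel_measurable \<mu>"
    unfolding g_def by measurable
  have g_int: "integrable \<mu> g"
    by (rule integrable_const_bound[of _ 1])
      (use g_meas prob_space.prob_le_1[OF prob_space_nstep] in \<open>auto simp: g_eq\<close>)
  have diff: "g x - g x' = (V_op P ^^ n) (\<lambda>(u, v). f u - f v) (x, x')" for x x'
    using fun_cong[OF nstep_diff_eq[OF f, of n], of "(x, x')"] by (simp add: g_def)
  \<comment> \<open>By stationarity \<open>\<mu>\<close> is the average of the \<open>n\<close>-step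
    laws over a starting point \<open>x2\<close> distributed as \<open>\<mu>\<close>.\<close>
  have "measure (nstep P n x1) A - measure \<mu> A = (\<integral>x2. g x1 - g x2 \<partial>\<mu>)"
    using g_int stationary_nstep[OF st f, of n] A \<mu> prob_space
    by (simp add: g_def[symmetric] g_eq[symmetric]) (simp add: f_def)
  also have "\<bar>\<dots>\<bar> \<le> (\<integral>x2. \<bar>g x1 - g x2\<bar> \<partial>\<mu>)" by (rule integral_abs_bound)
  also have "\<dots> \<le> (LINT x2:{x2. x2 \<noteq> x1}|\<mu>. (V_op P ^^ n) (\<lambda>_. 1) (x1, x2))"
    unfolding set_lebesgue_integral_def
  proof (rule integral_mono)
    \<comment> \<open>On the diagonal both sides are 0. Off it, two indicator values differ by at
      most 1, so \<open>V_pow_abs_le\<close> applies.\<close>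
    show "\<bar>g x1 - g x2\<bar> \<le> indicator {x2. x2 \<noteq> x1} x2 *\<^sub>R (V_op P ^^ n) (\<lambda>_. 1) (x1, x2)" for x2
    proof (cases "x2 = x1")
      case False
      then show ?thesis
        unfolding diff
        by (auto simp: offdiag_def f_def indicator_def intro!: V_pow_abs_le bdd_meas_diff[OF f, unfolded f_def indicator_def])
    qed simp
  qed (use g_int V_pow_1_section_integrable[OF st] in \<open>auto simp: set_integrable_def\<close>)
  finally show ?thesis .
qed

lemma
  assumes st: "stationary P \<mu>"
  shows tv_dist_le: "tv_dist (nstep P n x1) \<mu> \<le> (LINT x2:{x2. x2 \<noteq> x1}|\<mu>. (V_op P ^^ n) (\<lambda>_. 1) (x1, x2))"
    and tv_dist_nonneg: "0 \<le> tv_dist (nstep P n x1) \<mu>"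
proof -
  show "tv_dist (nstep P n x1) \<mu> \<le> (LINT x2:{x2. x2 \<noteq> x1}|\<mu>. (V_op P ^^ n) (\<lambda>_. 1) (x1, x2))"
    unfolding tv_dist_def using nstep_stationary_diff_le[OF st]
    by (intro cSUP_least) auto
  \<comment> \<open>The empty set contributes the value 0 to the supremum, and
    \<open>nstep_stationary_diff_le\<close> supplies the upper bound that makes the real supremum
    meaningful.\<close>
  have "\<bar>measure (nstep P n x1) {} - measure \<mu> {}\<bar> \<le> tv_dist (nstep P n x1) \<mu>"
    unfolding tv_dist_def using nstep_stationary_diff_le[OF st]
    by (intro cSUP_upper bdd_aboveI2) auto
  then show "0 \<le> tv_dist (nstep P n x1) \<mu>" by simp
qed

lemma set_integral_V_pow_1_le:
  assumes st: "stationary P \<mu>"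
  shows "(LINT x2:{x2. x2 \<noteq> x1}|\<mu>. (V_op P ^^ n) (\<lambda>_. 1) (x1, x2)) \<le> V_norm n"
proof -
  interpret prob_space \<mu> using st by (simp add: stationary_def)
  have "(LINT x2:{x2. x2 \<noteq> x1}|\<mu>. (V_op P ^^ n) (\<lambda>_. 1) (x1, x2)) \<le> (\<integral>x2. V_norm n \<partial>\<mu>)"
    unfolding set_lebesgue_integral_def
  proof (rule integral_mono)
    show "indicator {x2. x2 \<noteq> x1} x2 *\<^sub>R (V_op P ^^ n) (\<lambda>_. 1) (x1, x2) \<le> V_norm n" for x2
      using V_pow_1_le_V_norm[of "(x1, x2)" n]
      by (cases "x2 = x1") (auto simp: V_norm_def offdiag_def)
  qed (use V_pow_1_section_integrable[OF st] in \<open>auto simp: set_integrable_def\<close>)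
  then show ?thesis using prob_space by simp
qed

end

section \<open>Passage to exponential rates\<close>

theorem theorem1:
  fixes P :: "'s::topological_space \<Rightarrow> 's measure"
    and \<mu> :: "'s measure"
    and x1 :: 's
  assumes "markov_kernel P"
    and "stationary P \<mu>"
    and "(Id :: ('s \<times> 's) set) \<in> sets (borel \<Otimes>\<^sub>M borel)"
    and "(\<lambda>(x, x'). kappa P x x') \<in> borel_measurable (borel \<Otimes>\<^sub>M borel)"
    and "\<And>h. bdd_meas h \<Longrightarrow> bdd_meas (V_op P h)"
  shows "limsup (\<lambda>n. ereal (1 / real n) * eln (tv_dist (nstep P n x1) \<mu>))
           \<le> limsup (\<lambda>n. ereal (1 / real n) *
               eln (LINT x2:{x2. x2 \<noteq> x1}|\<mu>. (V_op P ^^ n) (\<lambda>_. 1) (x1, x2)))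
         \<and> limsup (\<lambda>n. ereal (1 / real n) *
               eln (LINT x2:{x2. x2 \<noteq> x1}|\<mu>. (V_op P ^^ n) (\<lambda>_. 1) (x1, x2)))
           \<le> eln (spec_rad (V_op P))"
proof -
  interpret coupled_chain P
    using assms by unfold_locales auto
  let ?I = "\<lambda>n. LINT x2:{x2. x2 \<noteq> x1}|\<mu>. (V_op P ^^ n) (\<lambda>_. 1) (x1, x2)"
  note bounds = tv_dist_le[OF assms(2), of _ x1] tv_dist_nonneg[OF assms(2), of _ x1]
  have I_nonneg: "0 \<le> ?I n" for n
    using bounds[of n] by linarith
  have 1: "limsup (\<lambda>n. ereal (1 / real n) * eln (tv_dist (nstep P n x1) \<mu>))
      \<le> limsup (\<lambda>n. ereal (1 / real n) * eln (?I n))"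
    by (intro Limsup_mono always_eventually allI ereal_mult_left_mono eln_mono bounds) simp
  \<comment> \<open>The inequality fails at \<open>n = 0\<close>, where the left side is 0 and the
    right side is \<open>eln 0\<close>, so it is only claimed eventually.\<close>
  have "eventually (\<lambda>n. ereal (1 / real n) * eln (?I n) \<le> eln (root n (V_norm n))) sequentially"
    using eventually_ge_at_top[of 1]
  proof eventually_elim
    case (elim n)
    then have "ereal (1 / real n) * eln (?I n) = eln (root n (?I n))"
      by (intro eln_root I_nonneg)
    also have "\<dots> \<le> eln (root n (V_norm n))"
      using elim set_integral_V_pow_1_le[OF assms(2)] I_nonneg by (intro eln_mono) auto
    finally show ?case .
  qed
  then have "limsup (\<lambda>n. ereal (1 / real n) * eln (?I n)) \<le> limsup (\<lambda>n. eln (root n (V_norm n)))"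
    by (rule Limsup_mono)
  also have "\<dots> \<le> eln (spec_rad (V_op P))"
    by (rule limsup_eln_le[OF V_norm_root_tendsto]) (simp add: V_norm_def real_root_ge_zero)
  finally show ?thesis using 1 by blast
qed

end
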